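(* Let $\mathcal U$ be a quasi-selective ultrafilter on $\mathbb N$. Then the relation $\approx_{\mathcal U}$ is an equivalence relation on $\mathcal P(\mathbb E)$ satisfying, for all $X,Y\subseteq\mathbb E$: (E0) if $|X\cap\mathbb E_n|\le|Y\cap\mathbb E_n|$ for all $n$, then $X\approx_{\mathcal U}Z$ for some $Z\subseteq Y$; (E1) $X\approx_{\mathcal U}Y$ iff $X\setminus Y\approx_{\mathcal U}Y\setminus X$; (E2) exactly one of: $X\approx_{\mathcal U}Y$, $X'\approx_{\mathcal U}Y$ for some proper $X'\subset X$, $X\approx_{\mathcal U}Y'$ for some proper $Y'\subset Y$. Moreover, restricted to point sets $X,Y\subseteq\mathbb N^k$ (any $k\ge1$ for each), it agrees with the asymptotic equinumerosity corresponding to $\mathcal U$, i.e. $X\approx_{\mathcal U}Y$ iff $\{n:|X_n|=|Y_n|\}\in\mathcal U$. Finally, the map $\varphi_{\mathcal U}:[X]_{\approx_{\mathcal U}}\mapsto[\langle|X\cap\mathbb E_n|\rangle_{n\in\mathbb N}]_{\mathcal U}$ is well defined, satisfies $\varphi_{\mathcal U}([X\cup Y])=\varphi_{\mathcal U}([X])+\varphi_{\mathcal U}([Y])$ for disjoint $X,Y\subseteq\mathbb E$, and is an order isomorphism between $\mathcal P(\mathbb E)/\!\approx_{\mathcal U}$ (ordered by $[X]<[Y]$ iff $X\approx_{\mathcal U}Y'$ for some proper $Y'\subset Y$) and the initial segment $\mathbb S_{\mathcal U}=\{\xi\in\mathbb N^{\mathbb N}/\mathcal U: \xi\le[\langle|\mathbb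 E_n|\rangle_{n}]_{\mathcal U}\}$ of the ultrapower.
   Context: $\mathbb N=\{0,1,2,\dots\}$. A nonprincipal ultrafilter on $\mathbb N$ is quasi-selective if every $f:\mathbb N\to\mathbb N$ with $f(n)\le n$ agrees on a set in it with a nondecreasing function. $\mathbb E=\bigcup_{k\ge1}\mathbb N^k$ and $\mathbb E_n=\bigcup_{1\le k\le n}\{0,\dots,n\}^k$. A $\mathcal U$-isometry is a bijection $\sigma:\mathbb E\to\mathbb E$ with $\{n:\sigma[\mathbb E_n]=\mathbb E_n\}\in\mathcal U$. For $X,Y\subseteq\mathbb E$, $X\approx_{\mathcal U}Y$ iff $\sigma[X]=Y$ for some $\mathcal U$-isometry $\sigma$. For $X\subseteq\mathbb N^k$, $X_n=\{x\in X: x_i\le n\ \forall i\}$. $[g]_{\mathcal U}$ denotes the class of $g$ in the ultrapower $\mathbb N^{\mathbb N}/\mathcal U$, with pointwise sum and order modulo $\mathcal U$. *)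

theory Defs
  imports Main
begin

text \<open>
  A set-theoretic filter is rendered by the library type of filters: the set \<open>{n. P n}\<close>
  belongs to \<open>U\<close> iff \<open>eventually P U\<close>. The type contains the improper filter \<open>bot\<close>, which
  has to be excluded.
\<close>

definition ultrafilter :: "'a filter \<Rightarrow> bool" where
  "ultrafilter U \<longleftrightarrow> U \<noteq> bot \<and> (\<forall>P. eventually P U \<or> eventually (\<lambda>x. \<not> P x) U)"

definition nonprincipal :: "'a filter \<Rightarrow> bool" where
  "nonprincipal U \<longleftrightarrow> (\<forall>a. \<not> eventually (\<lambda>x. x = a) U)"

definition quasi_selective :: "nat filter \<Rightarrow> bool" where
  "quasi_selective U \<longleftrightarrow> ultrafilter U \<and> nonprincipal U \<and>
     (\<forall>f :: nat \<Rightarrow> nat. (\<forall>n. f n \<le> n) \<longrightarrow>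
        (\<exists>g :: nat \<Rightarrow> nat. mono g \<and> eventually (\<lambda>n. f n = g n) U))"

text \<open>A \<open>k\<close>-tuple of natural numbers is a list of length \<open>k\<close>.\<close>

definition tuples :: "nat \<Rightarrow> nat list set" where
  "tuples k = {x. length x = k}"

definition EE :: "nat list set" where
  "EE = (\<Union>k\<in>{1..}. tuples k)"

definition EEn :: "nat \<Rightarrow> nat list set" where
  "EEn n = (\<Union>k\<in>{1..n}. {x \<in> tuples k. set x \<subseteq> {0..n}})"

lemma finite_EEn: "finite (EEn n)"
proof -
  have "finite {x \<in> tuples k. set x \<subseteq> {0..n}}" for k
    using finite_lists_length_eq[of "{0..n}" k]
    by (simp add: tuples_def conj_commute)
  then show ?thesis unfolding EEn_def by blast
qed

text \<open>
  An isometry is a permutation of \<open>EE\<close>; its values on the empty list, which is outside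
  \<open>EE\<close>, are irrelevant.
\<close>

definition isometry :: "nat filter \<Rightarrow> (nat list \<Rightarrow> nat list) \<Rightarrow> bool" where
  "isometry U \<sigma> \<longleftrightarrow> bij_betw \<sigma> EE EE \<and> eventually (\<lambda>n. \<sigma> ` EEn n = EEn n) U"

definition isom_rel :: "nat filter \<Rightarrow> nat list set rel" where
  "isom_rel U = {(X, Y). X \<subseteq> EE \<and> Y \<subseteq> EE \<and> (\<exists>\<sigma>. isometry U \<sigma> \<and> \<sigma> ` X = Y)}"

abbreviation isometric ::
    "nat list set \<Rightarrow> nat filter \<Rightarrow> nat list set \<Rightarrow> bool" ("(_ \<approx>\<^bsub>_\<^esub> _)" [51, 0, 51] 50) where
  "X \<approx>\<^bsub>U\<^esub> Y \<equiv> (X, Y) \<in> isom_rel U"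

abbreviation isom_class :: "nat filter \<Rightarrow> nat list set \<Rightarrow> nat list set set" where
  "isom_class U X \<equiv> isom_rel U `` {X}"

definition class_less :: "nat filter \<Rightarrow> nat list set set \<Rightarrow> nat list set set \<Rightarrow> bool" where
  "class_less U C D \<longleftrightarrow> (\<exists>X\<in>C. \<exists>Y\<in>D. \<exists>Y'. Y' \<subset> Y \<and> X \<approx>\<^bsub>U\<^esub> Y')"

definition exactly_one :: "bool \<Rightarrow> bool \<Rightarrow> bool \<Rightarrow> bool" where
  "exactly_one A B C \<longleftrightarrow> (A \<and> \<not> B \<and> \<not> C) \<or> (\<not> A \<and> B \<and> \<not> C) \<or> (\<not> A \<and> \<not> B \<and> C)"

definition trunc :: "nat list set \<Rightarrow> nat \<Rightarrow> nat list set" where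
  "trunc X n = {x \<in> X. \<forall>i < length x. x ! i \<le> n}"

lemma finite_trunc:
  assumes "X \<subseteq> tuples k"
  shows "finite (trunc X n)"
proof (rule finite_subset)
  show "trunc X n \<subseteq> {x. set x \<subseteq> {0..n} \<and> length x = k}"
    using assms by (auto simp: trunc_def tuples_def in_set_conv_nth)
  show "finite {x. set x \<subseteq> {0..n} \<and> length x = k}"
    by (rule finite_lists_length_eq) simp
qed

definition asymp_equinumerous :: "nat filter \<Rightarrow> nat list set \<Rightarrow> nat list set \<Rightarrow> bool" where
  "asymp_equinumerous U X Y \<longleftrightarrow> eventually (\<lambda>n. card (trunc X n) = card (trunc Y n)) U"

definition ultra_rel :: "nat filter \<Rightarrow> (nat \<Rightarrow> nat) rel" where
  "ultra_rel U = {(f, g). eventually (\<lambda>n. f n = g n) U}"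

abbreviation ultra_class :: "nat filter \<Rightarrow> (nat \<Rightarrow> nat) \<Rightarrow> (nat \<Rightarrow> nat) set" where
  "ultra_class U f \<equiv> ultra_rel U `` {f}"

definition ultrapower :: "nat filter \<Rightarrow> (nat \<Rightarrow> nat) set set" where
  "ultrapower U = UNIV // ultra_rel U"

definition ultra_add ::
    "nat filter \<Rightarrow> (nat \<Rightarrow> nat) set \<Rightarrow> (nat \<Rightarrow> nat) set \<Rightarrow> (nat \<Rightarrow> nat) set" where
  "ultra_add U \<xi> \<eta> = (\<Union>f\<in>\<xi>. \<Union>g\<in>\<eta>. ultra_class U (\<lambda>n. f n + g n))"

definition ultra_le :: "nat filter \<Rightarrow> (nat \<Rightarrow> nat) set \<Rightarrow> (nat \<Rightarrow> nat) set \<Rightarrow> bool" where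
  "ultra_le U \<xi> \<eta> \<longleftrightarrow> (\<exists>f\<in>\<xi>. \<exists>g\<in>\<eta>. eventually (\<lambda>n. f n \<le> g n) U)"

definition ultra_less :: "nat filter \<Rightarrow> (nat \<Rightarrow> nat) set \<Rightarrow> (nat \<Rightarrow> nat) set \<Rightarrow> bool" where
  "ultra_less U \<xi> \<eta> \<longleftrightarrow> ultra_le U \<xi> \<eta> \<and> \<xi> \<noteq> \<eta>"

lemma equiv_ultra_rel: "equiv UNIV (ultra_rel U)"
  by (rule equivI)
    (auto simp: ultra_rel_def refl_on_def sym_def trans_def eq_commute elim: eventually_elim2)

lemma ultra_add_class:
  "ultra_add U (ultra_class U f) (ultra_class U g) = ultra_class U (\<lambda>n. f n + g n)"
proof -
  have "(\<lambda>f g. ultra_class U (\<lambda>n. f n + g n)) respects2 ultra_rel U"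
  proof (rule congruent2I'[OF equiv_class_eq[OF equiv_ultra_rel]])
    fix f f' g g'
    assume "(f, f') \<in> ultra_rel U" "(g, g') \<in> ultra_rel U"
    then show "((\<lambda>n. f n + g n), (\<lambda>n. f' n + g' n)) \<in> ultra_rel U"
      by (auto simp: ultra_rel_def elim: eventually_elim2)
  qed
  from UN_equiv_class2[OF equiv_ultra_rel equiv_ultra_rel this, of f g]
  show ?thesis by (simp add: ultra_add_def)
qed

lemma ultra_le_class:
  "ultra_le U (ultra_class U f) (ultra_class U g) \<longleftrightarrow> eventually (\<lambda>n. f n \<le> g n) U"
proof
  assume "ultra_le U (ultra_class U f) (ultra_class U g)"
  then obtain f' g' where "eventually (\<lambda>n. f n = f' n) U" "eventually (\<lambda>n. g n = g' n) U"
    "eventually (\<lambda>n. f' n \<le> g' n) U"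
    by (auto simp: ultra_le_def ultra_rel_def)
  then show "eventually (\<lambda>n. f n \<le> g n) U"
    by eventually_elim simp
next
  assume "eventually (\<lambda>n. f n \<le> g n) U"
  moreover have "f \<in> ultra_class U f" "g \<in> ultra_class U g"
    by (simp_all add: ultra_rel_def)
  ultimately show "ultra_le U (ultra_class U f) (ultra_class U g)"
    unfolding ultra_le_def by blast
qed

definition ultra_segment :: "nat filter \<Rightarrow> (nat \<Rightarrow> nat) set set" where
  "ultra_segment U = {\<xi> \<in> ultrapower U. ultra_le U \<xi> (ultra_class U (\<lambda>n. card (EEn n)))}"

definition count_class :: "nat filter \<Rightarrow> nat list set \<Rightarrow> (nat \<Rightarrow> nat) set" where
  "count_class U X = ultra_class U (\<lambda>n. card (X \<inter> EEn n))"

text \<open>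
  The map induced by \<open>count_class U\<close> on the classes of \<open>isom_rel U\<close>: the union over all
  representatives is their common value once \<open>count_class U\<close> is known to respect \<open>isom_rel U\<close>.
\<close>

definition phi :: "nat filter \<Rightarrow> nat list set set \<Rightarrow> (nat \<Rightarrow> nat) set" where
  "phi U C = (\<Union>X\<in>C. count_class U X)"

end

theory Submission
  imports Defs "HOL-Library.Infinite_Set" "HOL-Library.Disjoint_Sets"
begin

text \<open>
  Matching \<open>X\<close> with \<open>Y\<close> and their complements block by block, between consecutive elements of
  the set of \<open>n\<close> where the counts \<open>card (X \<inter> EEn n)\<close> and \<open>card (Y \<inter> EEn n)\<close> agree, shows that
  two sets are isometric iff their counts agree on a set in \<open>U\<close>. What remains is to realize
  every \<open>h\<close> below the counts of \<open>Y\<close> by a subset of \<open>Y\<close>, which is possible as soon as \<open>h\<close> and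
  its difference from the counts of \<open>Y\<close> are both nondecreasing on a set in \<open>U\<close>.

  Quasi-selectivity gives this only for functions bounded by \<open>n\<close>, whereas \<open>card (EEn n)\<close> grows
  like \<open>n\<^sup>n\<close>. But applied to functions that decrease on long intervals, it yields a set in
  \<open>U\<close> whose elements at least double; on such a set intervals of exponential length contain
  few points, so the argument can be repeated to get exponential and then iterated exponential
  gaps. On a set that sparse any \<open>f\<close> with \<open>n < f n \<le> card (EEn n)\<close> is automatically
  nondecreasing.
\<close>

section \<open>Filtrations by finite sets\<close>

lemma Int_filtration_Suc:
  assumes "mono F"
  shows "X \<inter> F (Suc n) = (X \<inter> F n) \<union> (X \<inter> disjointed F (Suc n))"
proof -
  have "F n \<subseteq> F (Suc n)" using assms by (simp add: mono_def)
  then show ?thesis using disjointed_mono[OF assms, of n] by blast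
qed

lemma card_Int_filtration_Suc:
  assumes "mono F" "\<And>n. finite (F n)"
  shows "card (X \<inter> F (Suc n)) = card (X \<inter> F n) + card (X \<inter> disjointed F (Suc n))"
  unfolding Int_filtration_Suc[OF assms(1)]
  by (rule card_Un_disjoint) (use assms in \<open>auto simp: disjointed_mono\<close>)

lemma UN_disjointed_filtration:
  fixes F :: "nat \<Rightarrow> 'a set"
  assumes "mono F"
  shows "(\<Union>i\<in>{0..<Suc n}. disjointed F i) = F n"
proof -
  have "(\<Union>i\<in>{0..<Suc n}. F i) = F n"
  proof (intro equalityI UN_least)
    fix i assume "i \<in> {0..<Suc n}"
    then show "F i \<subseteq> F n" by (intro monoD[OF assms]) simp
  qed auto
  then show ?thesis by (simp only: finite_UN_disjointed_eq)
qed

text \<open>Pick \<open>h i - h (i - 1)\<close> points of \<open>Y\<close> in each layer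
  \<open>disjointed F i\<close>; the counts then telescope to \<open>h\<close>. Monotonicity of
  \<open>h\<close> keeps the natural subtraction exact, and monotonicity of the difference says that
  each layer of \<open>Y\<close> has enough points. The difference is taken in the integers so that
  nothing is truncated.\<close>

lemma subset_with_prescribed_counts:
  fixes F :: "nat \<Rightarrow> 'a set" and h :: "nat \<Rightarrow> nat"
  assumes F: "mono F" "\<And>n. finite (F n)"
    and le: "h 0 \<le> card (Y \<inter> F 0)"
    and h: "mono h" and diff: "mono (\<lambda>n. int (card (Y \<inter> F n)) - int (h n))"
  obtains Z where "Z \<subseteq> Y" "\<And>n. card (Z \<inter> F n) = h n"
proof -
  define d where "d i = h i - (if i = 0 then 0 else h (i - 1))" for i
  have "\<exists>S. S \<subseteq> Y \<inter> disjointed F i \<and> card S = d i" for i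
  proof -
    have "d i \<le> card (Y \<inter> disjointed F i)"
    proof (cases i)
      case 0
      then show ?thesis using le by (simp add: d_def)
    next
      case (Suc j)
      have "int (card (Y \<inter> F j)) - int (h j) \<le> int (card (Y \<inter> F (Suc j))) - int (h (Suc j))"
        using monoD[OF diff, of j "Suc j"] by simp
      then show ?thesis
        using card_Int_filtration_Suc[OF F, of Y j] by (simp add: d_def Suc)
    qed
    then show ?thesis by (meson obtain_subset_with_card_n)
  qed
  then obtain S where S: "\<And>i. S i \<subseteq> Y \<inter> disjointed F i" "\<And>i. card (S i) = d i" by metis
  define Z where "Z = (\<Union>i. S i)"
  have ZD: "Z \<inter> disjointed F i = S i" for i
  proof
    show "Z \<inter> disjointed F i \<subseteq> S i"
    proof
      fix x assume "x \<in> Z \<inter> disjointed F i"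
      then obtain j where j: "x \<in> S j" "x \<in> disjointed F i" by (auto simp: Z_def)
      then have "x \<in> disjointed F j" using S(1) by blast
      then have "i = j"
        using j(2) disjoint_family_disjointed[of F] by (auto simp: disjoint_family_on_def)
      then show "x \<in> S i" using j(1) by simp
    qed
    show "S i \<subseteq> Z \<inter> disjointed F i" using S(1) by (auto simp: Z_def)
  qed
  have "card (Z \<inter> F n) = h n" for n
  proof (induction n)
    case 0
    then show ?case using ZD[of 0] S(2)[of 0] by (simp add: d_def)
  next
    case (Suc n)
    have "h n \<le> h (Suc n)" using h by (simp add: mono_def)
    then show ?case
      using Suc ZD[of "Suc n"] S(2)[of "Suc n"] card_Int_filtration_Suc[OF F, of Z n]
      by (simp add: d_def)
  qed
  moreover have "Z \<subseteq> Y" using S(1) by (auto simp: Z_def)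
  ultimately show ?thesis using that by blast
qed

text \<open>In a finite \<open>D\<close>, equal parts leave equal complements, so a bijection of the
  parts and one of the complements glue to a permutation of \<open>D\<close>.\<close>

lemma bij_betw_extend_same_card:
  assumes "finite D" "card (X \<inter> D) = card (Y \<inter> D)"
  obtains s where "bij_betw s D D" "s ` (X \<inter> D) = Y \<inter> D"
proof -
  obtain f where f: "bij_betw f (X \<inter> D) (Y \<inter> D)"
    using assms finite_same_card_bij[of "X \<inter> D" "Y \<inter> D"] by auto
  have "card (D - X) = card (D - Y)"
    using assms by (simp add: card_Diff_subset_Int Int_commute)
  then obtain g where g: "bij_betw g (D - X) (D - Y)"
    using assms(1) finite_same_card_bij[of "D - X" "D - Y"] by auto
  have "bij_betw (\<lambda>x. if x \<in> X \<inter> D then f x else g x) ((X \<inter> D) \<union> (D - X)) ((Y \<inter> D) \<union> (D - Y))"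
    using f g by (rule bij_betw_disjoint_Un) auto
  moreover have "(X \<inter> D) \<union> (D - X) = D" "(Y \<inter> D) \<union> (D - Y) = D" by auto
  moreover have "(\<lambda>x. if x \<in> X \<inter> D then f x else g x) ` (X \<inter> D) = f ` (X \<inter> D)"
    by (rule image_cong) auto
  ultimately show ?thesis using that f by (metis (no_types, lifting) bij_betw_imp_surj_on)
qed

text \<open>Equal counts at all levels give equal counts in each layer, by subtraction of
  consecutive levels. Permutations of the layers glue to one permutation, and it preserves each
  \<open>F n\<close> because \<open>F n\<close> is a union of layers.\<close>

lemma filtration_preserving_bij:
  fixes F :: "nat \<Rightarrow> 'a set"
  assumes F: "mono F" "\<And>n. finite (F n)"
    and sub: "X \<subseteq> (\<Union>n. F n)" "Y \<subseteq> (\<Union>n. F n)"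
    and eq: "\<And>n. card (X \<inter> F n) = card (Y \<inter> F n)"
  obtains \<sigma> where "bij_betw \<sigma> (\<Union>n. F n) (\<Union>n. F n)" "\<sigma> ` X = Y" "\<And>n. \<sigma> ` F n = F n"
proof -
  let ?D = "disjointed F"
  have "\<exists>s. bij_betw s (?D i) (?D i) \<and> s ` (X \<inter> ?D i) = Y \<inter> ?D i" for i
  proof -
    have "card (X \<inter> ?D i) = card (Y \<inter> ?D i)"
    proof (cases i)
      case 0
      then show ?thesis using eq[of 0] by simp
    next
      case (Suc j)
      then show ?thesis
        using eq[of j] eq[of "Suc j"] card_Int_filtration_Suc[OF F, of X j]
          card_Int_filtration_Suc[OF F, of Y j] by simp
    qed
    moreover have "finite (?D i)" using F(2) disjointed_subset by (metis finite_subset)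
    ultimately show ?thesis by (metis bij_betw_extend_same_card)
  qed
  then obtain s where s: "\<And>i. bij_betw (s i) (?D i) (?D i)"
    "\<And>i. s i ` (X \<inter> ?D i) = Y \<inter> ?D i" by metis
  \<comment> \<open>The layers are disjoint, so \<open>SOME\<close> picks the only layer containing
    \<open>x\<close>.\<close>
  define \<sigma> where "\<sigma> x = s (SOME i. x \<in> ?D i) x" for x
  have \<sigma>: "\<sigma> x = s i x" if "x \<in> ?D i" for x i
  proof -
    have "(SOME i. x \<in> ?D i) = i"
    proof (rule some_equality)
      show "x \<in> ?D i" by (rule that)
    next
      fix j assume "x \<in> ?D j"
      then show "j = i"
        using that disjoint_family_disjointed[of F] by (auto simp: disjoint_family_on_def)
    qed
    then show ?thesis by (simp add: \<sigma>_def)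
  qed
  have bij: "bij_betw \<sigma> (?D i) (?D i)" for i
    using s(1)[of i] by (simp add: \<sigma> cong: bij_betw_cong)
  have XD: "\<sigma> ` (X \<inter> ?D i) = Y \<inter> ?D i" for i
  proof -
    have "\<sigma> ` (X \<inter> ?D i) = s i ` (X \<inter> ?D i)" by (rule image_cong) (simp_all add: \<sigma>)
    then show ?thesis using s(2)[of i] by simp
  qed
  have "bij_betw \<sigma> (\<Union>i. ?D i) (\<Union>i. ?D i)"
    by (rule bij_betw_UNION_disjoint) (auto simp: disjoint_family_disjointed bij)
  then have "bij_betw \<sigma> (\<Union>n. F n) (\<Union>n. F n)" by (simp add: UN_disjointed_eq)
  moreover have "\<sigma> ` X = Y"
  proof -
    have "S = (\<Union>i. S \<inter> ?D i)" if "S \<subseteq> (\<Union>n. F n)" for S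
      using that by (simp only: Int_UN_distrib[symmetric] UN_disjointed_eq Int_absorb2)
    then have X: "X = (\<Union>i. X \<inter> ?D i)" and Y: "Y = (\<Union>i. Y \<inter> ?D i)"
      using sub by blast+
    have "\<sigma> ` (\<Union>i. X \<inter> ?D i) = (\<Union>i. Y \<inter> ?D i)" by (simp only: image_UN XD)
    then show ?thesis using X Y by simp
  qed
  moreover have "\<sigma> ` F n = F n" for n
  proof -
    have "\<sigma> ` (\<Union>i\<in>{0..<Suc n}. ?D i) = (\<Union>i\<in>{0..<Suc n}. ?D i)"
      by (simp only: image_UN bij_betw_imp_surj_on[OF bij])
    then show ?thesis by (simp only: UN_disjointed_filtration[OF F(1)])
  qed
  ultimately show ?thesis using that by blast
qed

section \<open>Ultrafilters\<close>

lemma ultrafilter_eventually_not_iff: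
  assumes "ultrafilter U"
  shows "eventually (\<lambda>x. \<not> P x) U \<longleftrightarrow> \<not> eventually P U"
proof
  assume "eventually (\<lambda>x. \<not> P x) U"
  show "\<not> eventually P U"
  proof
    assume "eventually P U"
    with \<open>eventually (\<lambda>x. \<not> P x) U\<close> have "eventually (\<lambda>_. False) U" by eventually_elim simp
    then show False using assms by (simp add: ultrafilter_def)
  qed
qed (use assms in \<open>auto simp: ultrafilter_def\<close>)

text \<open>Used to fix a parity on a set in the ultrafilter without knowing which of the two it
  is.\<close>

lemma ultrafilter_obtain_value:
  assumes "ultrafilter U"
  obtains b :: bool where "eventually (\<lambda>x. P x = b) U"
proof (cases "eventually P U")
  case True
  then show ?thesis using that[of True] by simp
next
  case False
  then have "eventually (\<lambda>x. P x = False) U" using assms by (auto simp: ultrafilter_def)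
  then show ?thesis by (rule that)
qed

lemma nonprincipal_eventually_ge:
  fixes U :: "nat filter"
  assumes "ultrafilter U" "nonprincipal U"
  shows "eventually (\<lambda>n. m \<le> n) U"
proof -
  have "eventually (\<lambda>n. \<forall>a\<in>{..<m}. n \<noteq> a) U"
    using assms by (intro eventually_ball_finite)
      (auto simp: nonprincipal_def ultrafilter_eventually_not_iff)
  then show ?thesis by eventually_elim (auto simp: not_less[symmetric])
qed

lemma nonprincipal_infinite:
  fixes U :: "nat filter"
  assumes U: "ultrafilter U" "nonprincipal U" and A: "eventually (\<lambda>n. n \<in> A) U"
  shows "infinite A"
proof
  assume "finite A"
  then obtain m where m: "\<And>n. n \<in> A \<Longrightarrow> n < m" using finite_nat_set_iff_bounded[of A] by auto
  have "eventually (\<lambda>_. False) U"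
    using A nonprincipal_eventually_ge[OF U, of m] by eventually_elim (use m in fastforce)
  then show False using U(1) by (simp add: ultrafilter_def)
qed

section \<open>Sparse sets in a quasi-selective ultrafilter\<close>

text \<open>Quasi-selectivity wants the bound at every \<open>n\<close>, so it is applied to
  \<open>min (f n) n\<close>. A set on which \<open>f\<close> is monotone replaces the monotone
  function because such sets can be intersected with others.\<close>

lemma quasi_selective_mono_on:
  assumes "quasi_selective U" "eventually (\<lambda>n. f n \<le> n) U"
  obtains A where "eventually (\<lambda>n. n \<in> A) U" "mono_on A f"
proof -
  obtain g where g: "mono g" "eventually (\<lambda>n. min (f n) n = g n) U"
    using assms(1) unfolding quasi_selective_def by (auto dest!: spec[of _ "\<lambda>n. min (f n) n"])
  have "eventually (\<lambda>n. n \<in> {n. f n = g n}) U"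
    using g(2) assms(2) by eventually_elim (simp add: min_def)
  moreover have "mono_on {n. f n = g n} f"
    using g(1) by (auto simp: mono_on_def mono_def)
  ultimately show ?thesis using that by blast
qed

text \<open>All pairs are constrained, not only neighbours, so the property passes to
  subsets.\<close>

definition gaps :: "(nat \<Rightarrow> nat) \<Rightarrow> nat set \<Rightarrow> bool" where
  "gaps F A \<longleftrightarrow> (\<forall>a\<in>A. \<forall>b\<in>A. a < b \<longrightarrow> F a \<le> b)"

text \<open>
  Cut \<open>\<nat>\<close> at the iterates of \<open>F\<close>. Counting the points of \<open>A\<close> that remain in the current
  interval is a function \<open>\<le> n\<close> that strictly decreases on each interval, so a set on which
  it is nondecreasing meets each interval at most once; keeping every other interval then
  leaves gaps of size \<open>F\<close>.
\<close>

lemma quasi_selective_gaps: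
  assumes U: "quasi_selective U" and A: "eventually (\<lambda>n. n \<in> A) U"
    and F: "mono F" "\<And>n. n < F n"
    and card: "\<And>n. card (A \<inter> {n..<F n}) \<le> Suc n"
  obtains B where "eventually (\<lambda>n. n \<in> B) U" "gaps F B"
proof -
  define T where "T k = (F ^^ k) 0" for k
  have T0: "T 0 = 0" and TS: "T (Suc k) = F (T k)" for k by (simp_all add: T_def)
  have T: "strict_mono T" by (simp add: strict_mono_Suc_iff TS F(2))
  \<comment> \<open>The index of the interval from \<open>T k\<close> to \<open>T (Suc k)\<close>
    that contains \<open>n\<close>.\<close>
  define k where "k n = (LEAST k. n < T (Suc k))" for n
  have upper: "n < T (Suc (k n))" for n
  proof -
    have "n < T (Suc n)" using strict_mono_imp_increasing[OF T, of "Suc n"] by simp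
    then show ?thesis unfolding k_def by (rule LeastI[of "\<lambda>k. n < T (Suc k)"])
  qed
  have lower: "T (k n) \<le> n" for n
  proof (cases "k n")
    case (Suc j)
    then have "\<not> n < T (Suc j)" unfolding k_def by (metis lessI not_less_Least)
    then show ?thesis using Suc by simp
  qed (simp add: T0)
  \<comment> \<open>Only points strictly after \<open>n\<close> count. For \<open>n\<close> in
    \<open>A\<close> the point \<open>n\<close> itself is thus left out, which turns the bound
    \<open>Suc (T (k n))\<close> on the whole interval into
    \<open>f n \<le> T (k n) \<le> n\<close>.\<close>
  define f where "f n = card (A \<inter> {n<..<T (Suc (k n))})" for n
  have "f n \<le> n" if "n \<in> A" for n
  proof -
    have "Suc (f n) = card (insert n (A \<inter> {n<..<T (Suc (k n))}))" by (simp add: f_def)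
    also have "\<dots> \<le> card (A \<inter> {T (k n)..<F (T (k n))})"
      using that lower[of n] upper[of n] by (intro card_mono) (auto simp: TS)
    also have "\<dots> \<le> Suc (T (k n))" by (rule card)
    finally show ?thesis using lower[of n] by simp
  qed
  then have "eventually (\<lambda>n. f n \<le> n) U" using A by (auto elim: eventually_mono)
  then obtain B where B: "eventually (\<lambda>n. n \<in> B) U" "mono_on B f"
    using quasi_selective_mono_on U by blast
  obtain p where p: "eventually (\<lambda>n. even (k n) = p) U"
    using U ultrafilter_obtain_value[of U "\<lambda>n. even (k n)"]
    unfolding quasi_selective_def by blast
  have "eventually (\<lambda>n. n \<in> A \<inter> B \<inter> {n. even (k n) = p}) U"
    using A B(1) p by eventually_elim simp
  moreover have "gaps F (A \<inter> B \<inter> {n. even (k n) = p})"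
    unfolding gaps_def
  proof (intro ballI impI)
    fix a b assume ab: "a \<in> A \<inter> B \<inter> {n. even (k n) = p}" "b \<in> A \<inter> B \<inter> {n. even (k n) = p}" "a < b"
    have "k a \<le> k b"
      unfolding k_def[of a] by (rule Least_le) (use ab(3) upper[of b] in simp)
    moreover have "k a \<noteq> k b"
    proof
      assume eq: "k a = k b"
      have "f b < f a"
        unfolding f_def using ab upper[of b] by (intro psubset_card_mono) (auto simp: eq)
      moreover have "f a \<le> f b" using B(2) ab by (simp add: mono_on_def)
      ultimately show False by simp
    qed
    moreover have "even (k a) = even (k b)" using ab by simp
    \<comment> \<open>Different indices of equal parity differ by at least two. A whole interval
      thus separates \<open>a\<close> from \<open>b\<close>, which leaves room for one application
      of \<open>F\<close>.\<close>
    ultimately have "Suc (Suc (k a)) \<le> k b"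
      by (metis even_Suc le_neq_implies_less less_eq_Suc_le)
    have "F a \<le> F (T (Suc (k a)))" using upper[of a] by (intro monoD[OF F(1)]) simp
    also have "\<dots> = T (Suc (Suc (k a)))" by (simp add: TS)
    also have "\<dots> \<le> T (k b)" using \<open>Suc (Suc (k a)) \<le> k b\<close> T by (simp add: strict_mono_less_eq)
    also have "\<dots> \<le> b" by (rule lower)
    finally show "F a \<le> b" .
  qed
  ultimately show ?thesis using that by blast
qed

text \<open>Keep the elements of \<open>A\<close> whose rank \<open>r\<close> in \<open>A\<close>
  has a fixed parity. Between two kept elements \<open>a < b\<close> lies some \<open>c\<close> in
  \<open>A\<close>, and the gap property applied twice gives
  \<open>F (F a) \<le> F c \<le> b\<close>.\<close>

lemma ultrafilter_gaps_compose:
  fixes U :: "nat filter"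
  assumes U: "ultrafilter U" and A: "eventually (\<lambda>n. n \<in> A) U" "gaps F A" and F: "mono F"
  obtains B where "eventually (\<lambda>n. n \<in> B) U" "gaps (\<lambda>n. F (F n)) B"
proof -
  define r where "r n = card (A \<inter> {..<n})" for n
  obtain p where p: "eventually (\<lambda>n. even (r n) = p) U"
    using ultrafilter_obtain_value[OF U, of "\<lambda>n. even (r n)"] by blast
  have "eventually (\<lambda>n. n \<in> A \<inter> {n. even (r n) = p}) U"
    using A(1) p by eventually_elim simp
  moreover have "gaps (\<lambda>n. F (F n)) (A \<inter> {n. even (r n) = p})"
    unfolding gaps_def
  proof (intro ballI impI)
    fix a b assume ab: "a \<in> A \<inter> {n. even (r n) = p}" "b \<in> A \<inter> {n. even (r n) = p}" "a < b"
    have "\<exists>c\<in>A. a < c \<and> c < b"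
    proof (rule ccontr)
      assume "\<not> (\<exists>c\<in>A. a < c \<and> c < b)"
      then have "A \<inter> {..<b} = insert a (A \<inter> {..<a})"
        using ab by (auto simp: not_less)
      then have "r b = Suc (r a)" by (simp add: r_def)
      then show False using ab by auto
    qed
    then obtain c where c: "c \<in> A" "a < c" "c < b" by blast
    have "F (F a) \<le> F c" using A(2) ab c by (intro monoD[OF F]) (auto simp: gaps_def)
    also have "\<dots> \<le> b" using A(2) ab c by (auto simp: gaps_def)
    finally show "F (F a) \<le> b" .
  qed
  ultimately show ?thesis using that by blast
qed

text \<open>Each block from \<open>2 ^ n\<close> to \<open>2 ^ Suc n\<close> holds at most one point
  of \<open>A\<close>, since a second one would be at least \<open>2 * 2 ^ n + 1\<close>. The extra
  one in the bound accounts for the point 0.\<close>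

lemma card_below_power_if_gaps:
  assumes "gaps (\<lambda>n. 2 * n + 1) A"
  shows "card (A \<inter> {..<2 ^ n}) \<le> Suc n"
proof (induction n)
  case 0
  have "card (A \<inter> {..<2 ^ 0}) \<le> card {0::nat}" by (rule card_mono) auto
  then show ?case by simp
next
  case (Suc n)
  have "card (A \<inter> {2 ^ n..<2 ^ Suc n}) \<le> Suc 0"
  proof (rule iffD2[OF card_le_Suc0_iff_eq])
    have False if "a \<in> A" "b \<in> A" "a < b" "2 ^ n \<le> a" "b < 2 * 2 ^ n" for a b
      using assms that by (fastforce simp: gaps_def)
    then show "\<forall>a\<in>A \<inter> {2 ^ n..<2 ^ Suc n}. \<forall>b\<in>A \<inter> {2 ^ n..<2 ^ Suc n}. a = b"
      by (auto simp: neq_iff) (metis linorder_neqE_nat)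
  qed simp
  moreover have "A \<inter> {..<2 ^ Suc n} = (A \<inter> {..<2 ^ n}) \<union> (A \<inter> {2 ^ n..<2 ^ Suc n})" by auto
  ultimately show ?case
    using Suc card_Un_le[of "A \<inter> {..<2 ^ n}" "A \<inter> {2 ^ n..<2 ^ Suc n}"] by simp
qed

text \<open>Each round thins the set enough to satisfy the counting hypothesis of
  \<open>quasi_selective_gaps\<close> for a faster function. Composing the exponential gaps twice
  gives four exponentials, one more than the bound on \<open>card (EEn n)\<close> in
  \<open>card_EEn_le\<close>.\<close>

lemma quasi_selective_tower_gaps:
  assumes U: "quasi_selective U"
  obtains A where "eventually (\<lambda>n. n \<in> A) U" "gaps (\<lambda>n. 2 ^ 2 ^ 2 ^ 2 ^ n) A"
proof -
  have uf: "ultrafilter U" using U by (simp add: quasi_selective_def)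
  \<comment> \<open>With all of the naturals as the starting set, \<open>2 * n + 1\<close> is the
    largest admissible choice: the interval from \<open>n\<close> has exactly \<open>Suc n\<close>
    points.\<close>
  obtain A where A: "eventually (\<lambda>n. n \<in> A) U" "gaps (\<lambda>n. 2 * n + 1) A"
    by (rule quasi_selective_gaps[OF U, of UNIV "\<lambda>n. 2 * n + 1"]) (auto simp: mono_def)
  have "card (A \<inter> {n..<2 ^ n}) \<le> Suc n" for n
  proof -
    have "card (A \<inter> {n..<2 ^ n}) \<le> card (A \<inter> {..<2 ^ n})" by (rule card_mono) auto
    then show ?thesis using card_below_power_if_gaps[OF A(2), of n] by simp
  qed
  then obtain B where B: "eventually (\<lambda>n. n \<in> B) U" "gaps (\<lambda>n. 2 ^ n) B"
    using quasi_selective_gaps[OF U A(1), of "\<lambda>n. 2 ^ n"] less_exp by (auto simp: mono_def)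
  obtain C where C: "eventually (\<lambda>n. n \<in> C) U" "gaps (\<lambda>n. 2 ^ 2 ^ n) C"
    using ultrafilter_gaps_compose[OF uf B] by (auto simp: mono_def)
  show ?thesis
    using ultrafilter_gaps_compose[OF uf C] that by (auto simp: mono_def)
qed

section \<open>Counting functions\<close>

lemma mono_EEn: "mono EEn"
  unfolding EEn_def by (rule monoI) fastforce

lemma UN_EEn: "(\<Union>n. EEn n) = EE"
proof
  show "(\<Union>n. EEn n) \<subseteq> EE" by (auto simp: EEn_def EE_def)
  show "EE \<subseteq> (\<Union>n. EEn n)"
  proof
    fix x assume x: "x \<in> EE"
    \<comment> \<open>Level \<open>n\<close> bounds the length of a tuple as well as its
      entries.\<close>
    have "x \<in> EEn (max (length x) (Max (set x)))"
      using x by (auto simp: EEn_def EE_def tuples_def le_max_iff_disj)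
    then show "x \<in> (\<Union>n. EEn n)" by blast
  qed
qed

text \<open>A crude bound, shaped for comparison with the iterated exponential gaps: there are at
  most \<open>n * Suc n ^ n\<close> tuples, and this is at most
  \<open>2 ^ (n * Suc n)\<close>.\<close>

lemma card_EEn_le: "card (EEn n) \<le> 2 ^ 2 ^ 2 ^ n"
proof -
  have Suc_le: "Suc n \<le> 2 ^ n" using less_exp[of n] by (simp only: Suc_le_eq)
  have "card (EEn n) \<le> (\<Sum>k\<in>{1..n}. card {x \<in> tuples k. set x \<subseteq> {0..n}})"
    unfolding EEn_def by (rule card_UN_le) simp
  also have "\<dots> = (\<Sum>k\<in>{1..n}. Suc n ^ k)"
    using card_lists_length_eq[of "{0..n}"] by (simp add: tuples_def conj_commute)
  also have "\<dots> \<le> (\<Sum>k\<in>{1..n}. Suc n ^ n)"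
    by (rule sum_mono) (auto intro: power_increasing)
  also have "\<dots> = n * Suc n ^ n" by simp
  also have "\<dots> \<le> 2 ^ n * (2 ^ n) ^ n"
    using Suc_le by (intro mult_mono power_mono) simp_all
  also have "\<dots> = (2::nat) ^ (n * Suc n)" by (simp add: power_add power_mult)
  also have "\<dots> \<le> 2 ^ 2 ^ 2 ^ n"
  proof (rule power_increasing)
    have "n * Suc n \<le> 2 ^ n * 2 ^ n"
      using Suc_le by (intro mult_mono) simp_all
    also have "\<dots> = (2::nat) ^ (2 * n)" by (simp add: mult_2 power_add)
    also have "\<dots> \<le> 2 ^ 2 ^ n"
    proof (rule power_increasing)
      show "2 * n \<le> 2 ^ n"
      proof (cases n)
        case (Suc m)
        have "Suc m \<le> 2 ^ m" using less_exp[of m] by (simp only: Suc_le_eq)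
        then show ?thesis by (simp add: Suc)
      qed simp
    qed simp
    finally show "n * Suc n \<le> 2 ^ 2 ^ n" .
  qed simp
  finally show ?thesis .
qed

text \<open>
  On a set with gaps exceeding \<open>card (EEn n)\<close>, a function \<open>f\<close> between \<open>n\<close> and \<open>card (EEn n)\<close>
  is nondecreasing because \<open>f a \<le> card (EEn a) \<le> b \<le> f b\<close>.
\<close>

lemma quasi_selective_mono_on_card_EEn:
  assumes U: "quasi_selective U" and f: "eventually (\<lambda>n. f n \<le> card (EEn n)) U"
  obtains A where "eventually (\<lambda>n. n \<in> A) U" "mono_on A f"
proof (cases "eventually (\<lambda>n. f n \<le> n) U")
  case True
  then show ?thesis using quasi_selective_mono_on[OF U] that by blast
next
  case False
  then have "eventually (\<lambda>n. \<not> f n \<le> n) U"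
    using U by (simp add: quasi_selective_def ultrafilter_eventually_not_iff)
  obtain A where A: "eventually (\<lambda>n. n \<in> A) U" "gaps (\<lambda>n. 2 ^ 2 ^ 2 ^ 2 ^ n) A"
    using quasi_selective_tower_gaps[OF U] .
  have "eventually (\<lambda>n. n \<in> {n\<in>A. f n \<le> card (EEn n) \<and> n < f n}) U"
    using A(1) f \<open>eventually (\<lambda>n. \<not> f n \<le> n) U\<close> by eventually_elim simp
  moreover have "mono_on {n\<in>A. f n \<le> card (EEn n) \<and> n < f n} f"
  proof (rule mono_onI)
    fix a b
    assume ab: "a \<in> {n\<in>A. f n \<le> card (EEn n) \<and> n < f n}"
      "b \<in> {n\<in>A. f n \<le> card (EEn n) \<and> n < f n}" "a \<le> b"
    show "f a \<le> f b"
    proof (cases "a = b")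
      case False
      have "f a \<le> 2 ^ 2 ^ 2 ^ a" using ab card_EEn_le[of a] by simp
      also have "\<dots> \<le> 2 ^ 2 ^ 2 ^ 2 ^ a" by (rule less_imp_le, rule less_exp)
      also have "\<dots> \<le> b" using A(2) ab False by (simp add: gaps_def)
      also have "\<dots> \<le> f b" using ab by simp
      finally show ?thesis .
    qed simp
  qed
  ultimately show ?thesis using that by blast
qed

text \<open>Restricting to the levels in \<open>A\<close> and renumbering them turns monotonicity on
  \<open>A\<close> into the monotonicity of sequences that the filtration lemmas ask for.\<close>

lemma mono_on_comp_enumerate:
  assumes "mono_on A f" "infinite A"
  shows "mono (\<lambda>i. f (enumerate A i))"
proof (rule monoI)
  fix i j :: nat assume "i \<le> j"
  then have "enumerate A i \<le> enumerate A j" using assms(2) by simp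
  then show "f (enumerate A i) \<le> f (enumerate A j)"
    using assms by (simp add: mono_on_def enumerate_in_set)
qed

text \<open>Both \<open>h\<close> and its difference \<open>d\<close> from the counts of
  \<open>Y\<close> are bounded by \<open>card (EEn n)\<close> on a set in \<open>U\<close>, hence
  nondecreasing on sets in \<open>U\<close>. Along the levels in a common subset \<open>C\<close>,
  counts can be prescribed.\<close>

lemma quasi_selective_realize_count:
  assumes U: "quasi_selective U" and h: "eventually (\<lambda>n. h n \<le> card (Y \<inter> EEn n)) U"
  obtains Z where "Z \<subseteq> Y" "eventually (\<lambda>n. card (Z \<inter> EEn n) = h n) U"
proof -
  define d where "d n = card (Y \<inter> EEn n) - h n" for n
  have Y: "card (Y \<inter> EEn n) \<le> card (EEn n)" for n
    by (rule card_mono) (auto simp: finite_EEn)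
  have "eventually (\<lambda>n. h n \<le> card (EEn n)) U"
    using h by eventually_elim (use Y le_trans in blast)
  then obtain A where A: "eventually (\<lambda>n. n \<in> A) U" "mono_on A h"
    using quasi_selective_mono_on_card_EEn[OF U, of h] by blast
  have "d n \<le> card (EEn n)" for n using Y[of n] by (simp add: d_def)
  then obtain B where B: "eventually (\<lambda>n. n \<in> B) U" "mono_on B d"
    using quasi_selective_mono_on_card_EEn[OF U, of d] by auto
  \<comment> \<open>The inequality is included so that on \<open>C\<close> the truncated subtraction
    in \<open>d\<close> is the integer difference.\<close>
  define C where "C = {n \<in> A \<inter> B. h n \<le> card (Y \<inter> EEn n)}"
  have C: "eventually (\<lambda>n. n \<in> C) U"
    using A(1) B(1) h by eventually_elim (simp add: C_def)
  then have inf: "infinite C" using nonprincipal_infinite[of U C] U by (simp add: quasi_selective_def)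
  have hC: "mono_on C h" using A(2) by (auto simp: mono_on_def C_def)
  have dC: "mono_on C (\<lambda>n. int (card (Y \<inter> EEn n)) - int (h n))"
  proof (rule mono_onI)
    fix a b assume ab: "a \<in> C" "b \<in> C" "a \<le> b"
    then have "d a \<le> d b" using B(2) by (auto simp: mono_on_def C_def)
    then show "int (card (Y \<inter> EEn a)) - int (h a) \<le> int (card (Y \<inter> EEn b)) - int (h b)"
      using ab by (auto simp: d_def C_def)
  qed
  have mono_E: "mono (\<lambda>i. EEn (enumerate C i))"
    by (rule mono_on_comp_enumerate[OF _ inf]) (use mono_EEn in \<open>auto simp: mono_on_def mono_def\<close>)
  have "enumerate C 0 \<in> C" using inf by (rule enumerate_in_set)
  then have "h (enumerate C 0) \<le> card (Y \<inter> EEn (enumerate C 0))" by (simp add: C_def)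
  then obtain Z where Z: "Z \<subseteq> Y" "\<And>i. card (Z \<inter> EEn (enumerate C i)) = h (enumerate C i)"
    using subset_with_prescribed_counts[of "\<lambda>i. EEn (enumerate C i)" "\<lambda>i. h (enumerate C i)" Y]
      mono_on_comp_enumerate[OF hC inf] mono_on_comp_enumerate[OF dC inf] mono_E finite_EEn
    by metis
  have "eventually (\<lambda>n. card (Z \<inter> EEn n) = h n) U"
    using C by eventually_elim (metis Z(2) enumerate_Ex inf)
  then show ?thesis using Z(1) that by blast
qed

section \<open>Isometries and counting functions\<close>

text \<open>An isometry maps \<open>X \<inter> EEn n\<close> injectively onto
  \<open>Y \<inter> EEn n\<close> whenever it preserves \<open>EEn n\<close>. Conversely, the levels
  where the counts agree form a filtration of their own, to which
  \<open>filtration_preserving_bij\<close> applies.\<close>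

lemma isometric_iff:
  assumes U: "ultrafilter U" "nonprincipal U"
  shows "X \<approx>\<^bsub>U\<^esub> Y \<longleftrightarrow>
    X \<subseteq> EE \<and> Y \<subseteq> EE \<and> eventually (\<lambda>n. card (X \<inter> EEn n) = card (Y \<inter> EEn n)) U"
proof (intro iffI)
  assume "X \<approx>\<^bsub>U\<^esub> Y"
  then obtain \<sigma> where X: "X \<subseteq> EE" and Y: "Y \<subseteq> EE" "\<sigma> ` X = Y"
    and \<sigma>: "bij_betw \<sigma> EE EE" "eventually (\<lambda>n. \<sigma> ` EEn n = EEn n) U"
    by (auto simp: isom_rel_def isometry_def)
  have inj: "inj_on \<sigma> EE" using \<sigma>(1) by (rule bij_betw_imp_inj_on)
  have "eventually (\<lambda>n. card (X \<inter> EEn n) = card (Y \<inter> EEn n)) U"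
    using \<sigma>(2)
  proof eventually_elim
    case (elim n)
    have E: "EEn n \<subseteq> EE" using UN_EEn by blast
    have "\<sigma> ` (X \<inter> EEn n) = Y \<inter> EEn n"
      using inj_on_image_Int[OF inj X E] Y(2) elim by simp
    moreover have "inj_on \<sigma> (X \<inter> EEn n)" using inj X by (auto intro: inj_on_subset)
    ultimately show ?case by (metis card_image)
  qed
  then show "X \<subseteq> EE \<and> Y \<subseteq> EE \<and> eventually (\<lambda>n. card (X \<inter> EEn n) = card (Y \<inter> EEn n)) U"
    using X Y by simp
next
  assume asm: "X \<subseteq> EE \<and> Y \<subseteq> EE \<and> eventually (\<lambda>n. card (X \<inter> EEn n) = card (Y \<inter> EEn n)) U"
  define A where "A = {n. card (X \<inter> EEn n) = card (Y \<inter> EEn n)}"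
  have A: "eventually (\<lambda>n. n \<in> A) U" using asm by (simp add: A_def)
  then have inf: "infinite A" by (rule nonprincipal_infinite[OF U])
  let ?F = "\<lambda>i. EEn (enumerate A i)"
  have F: "mono ?F"
    by (rule mono_on_comp_enumerate[OF _ inf]) (use mono_EEn in \<open>auto simp: mono_on_def mono_def\<close>)
  have UN: "(\<Union>i. ?F i) = EE"
  proof
    show "(\<Union>i. ?F i) \<subseteq> EE" using UN_EEn by blast
    \<comment> \<open>The \<open>n\<close>-th element of an infinite set of naturals is at least
      \<open>n\<close>, so the selected levels still exhaust \<open>EE\<close>.\<close>
    have "EEn n \<subseteq> ?F n" for n
      by (rule monoD[OF mono_EEn le_enumerate[OF inf]])
    then have "(\<Union>n. EEn n) \<subseteq> (\<Union>i. ?F i)" by (intro UN_mono) auto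
    then show "EE \<subseteq> (\<Union>i. ?F i)" by (simp only: UN_EEn)
  qed
  have eq: "card (X \<inter> ?F i) = card (Y \<inter> ?F i)" for i
    using enumerate_in_set[OF inf, of i] by (simp add: A_def)
  obtain \<sigma> where \<sigma>: "bij_betw \<sigma> EE EE" "\<sigma> ` X = Y" "\<And>i. \<sigma> ` ?F i = ?F i"
    using filtration_preserving_bij[OF F finite_EEn, of X Y] asm eq unfolding UN by metis
  have "eventually (\<lambda>n. \<sigma> ` EEn n = EEn n) U"
    using A by eventually_elim (metis \<sigma>(3) enumerate_Ex inf)
  then show "X \<approx>\<^bsub>U\<^esub> Y" using \<sigma> asm by (auto simp: isom_rel_def isometry_def)
qed

text \<open>A point of \<open>Y\<close> missing from \<open>Y'\<close> lies in some
  \<open>EEn m\<close> and makes the counts differ at all later levels, which form a set in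
  \<open>U\<close>. Conversely, a subset of \<open>Y\<close> realizing the counts of
  \<open>X\<close> is proper because those counts are strictly smaller.\<close>

lemma isometric_proper_subset_iff:
  assumes U: "quasi_selective U" and XY: "X \<subseteq> EE" "Y \<subseteq> EE"
  shows "(\<exists>Y'. Y' \<subset> Y \<and> X \<approx>\<^bsub>U\<^esub> Y') \<longleftrightarrow>
    eventually (\<lambda>n. card (X \<inter> EEn n) < card (Y \<inter> EEn n)) U"
proof
  have uf: "ultrafilter U" "nonprincipal U" using U by (auto simp: quasi_selective_def)
  assume "\<exists>Y'. Y' \<subset> Y \<and> X \<approx>\<^bsub>U\<^esub> Y'"
  then obtain Y' where Y': "Y' \<subset> Y"
    and eq: "eventually (\<lambda>n. card (X \<inter> EEn n) = card (Y' \<inter> EEn n)) U"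
    by (auto simp: isometric_iff[OF uf])
  then obtain y m where y: "y \<in> Y" "y \<notin> Y'" "y \<in> EEn m" using XY(2) UN_EEn by blast
  show "eventually (\<lambda>n. card (X \<inter> EEn n) < card (Y \<inter> EEn n)) U"
    using eq nonprincipal_eventually_ge[OF uf, of m]
  proof eventually_elim
    case (elim n)
    have "y \<in> EEn n" using y(3) elim(2) mono_EEn by (auto simp: mono_def)
    then have "card (Y' \<inter> EEn n) < card (Y \<inter> EEn n)"
      using Y' y finite_EEn by (intro psubset_card_mono) auto
    then show ?case using elim(1) by simp
  qed
next
  have uf: "ultrafilter U" "nonprincipal U" using U by (auto simp: quasi_selective_def)
  assume less: "eventually (\<lambda>n. card (X \<inter> EEn n) < card (Y \<inter> EEn n)) U"
  then have "eventually (\<lambda>n. card (X \<inter> EEn n) \<le> card (Y \<inter> EEn n)) U"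
    by eventually_elim simp
  then obtain Z where Z: "Z \<subseteq> Y" "eventually (\<lambda>n. card (Z \<inter> EEn n) = card (X \<inter> EEn n)) U"
    using quasi_selective_realize_count[OF U, of "\<lambda>n. card (X \<inter> EEn n)" Y] by blast
  have "Z \<noteq> Y"
  proof
    assume "Z = Y"
    from Z(2) less have "eventually (\<lambda>_. False) U"
      by eventually_elim (simp add: \<open>Z = Y\<close>)
    then show False using uf(1) by (simp add: ultrafilter_def)
  qed
  moreover have "X \<approx>\<^bsub>U\<^esub> Z" using Z XY by (auto simp: isometric_iff[OF uf] eq_commute)
  ultimately show "\<exists>Y'. Y' \<subset> Y \<and> X \<approx>\<^bsub>U\<^esub> Y'" using Z(1) by blast
qed

lemma equiv_isom_rel:
  assumes U: "ultrafilter U" "nonprincipal U"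
  shows "equiv (Pow EE) (isom_rel U)"
proof (rule equivI)
  show "isom_rel U \<subseteq> Pow EE \<times> Pow EE" by (auto simp: isom_rel_def)
  show "refl_on (Pow EE) (isom_rel U)"
    by (auto simp: refl_on_def isometric_iff[OF U])
  show "sym (isom_rel U)"
    by (auto simp: sym_def isometric_iff[OF U] eq_commute)
  show "trans (isom_rel U)"
  proof (rule transI)
    fix X Y Z assume XYZ: "X \<approx>\<^bsub>U\<^esub> Y" "Y \<approx>\<^bsub>U\<^esub> Z"
    then have "eventually (\<lambda>n. card (X \<inter> EEn n) = card (Y \<inter> EEn n)) U"
      "eventually (\<lambda>n. card (Y \<inter> EEn n) = card (Z \<inter> EEn n)) U"
      by (auto simp: isometric_iff[OF U])
    then have "eventually (\<lambda>n. card (X \<inter> EEn n) = card (Z \<inter> EEn n)) U"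
      by eventually_elim simp
    then show "X \<approx>\<^bsub>U\<^esub> Z" using XYZ by (simp add: isometric_iff[OF U])
  qed
qed

text \<open>The three conditions partition the index set, and an ultrafilter contains exactly one
  part of a finite partition.\<close>

lemma ultrafilter_exactly_one_less:
  fixes f g :: "'a \<Rightarrow> nat"
  assumes "ultrafilter U"
  shows "exactly_one (eventually (\<lambda>n. f n = g n) U) (eventually (\<lambda>n. g n < f n) U)
    (eventually (\<lambda>n. f n < g n) U)"
proof -
  have disj: "\<not> (eventually P U \<and> eventually Q U)" if "\<And>n. \<not> (P n \<and> Q n)" for P Q
  proof
    assume "eventually P U \<and> eventually Q U"
    then have "eventually (\<lambda>n. P n \<and> Q n) U" by (simp add: eventually_conj)
    then show False using assms that by (simp add: ultrafilter_def)
  qed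
  have "eventually (\<lambda>n. f n < g n) U"
    if "\<not> eventually (\<lambda>n. f n = g n) U" "\<not> eventually (\<lambda>n. g n < f n) U"
    using that[folded ultrafilter_eventually_not_iff[OF assms]] by eventually_elim simp
  then show ?thesis
    unfolding exactly_one_def
    using disj[of "\<lambda>n. f n = g n" "\<lambda>n. g n < f n"] disj[of "\<lambda>n. f n = g n" "\<lambda>n. f n < g n"]
      disj[of "\<lambda>n. g n < f n" "\<lambda>n. f n < g n"] by auto
qed

text \<open>\<open>trunc\<close> bounds only the entries while \<open>EEn n\<close> also bounds the
  length; for \<open>k\<close>-tuples this makes no difference once
  \<open>k \<le> n\<close>.\<close>

lemma trunc_eq_Int_EEn:
  assumes "X \<subseteq> tuples k" "1 \<le> k" "k \<le> n"
  shows "trunc X n = X \<inter> EEn n"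
  using assms
  by (auto simp: trunc_def EEn_def tuples_def set_conv_nth subset_iff)

lemma ultra_class_eq_iff:
  "ultra_class U f = ultra_class U g \<longleftrightarrow> eventually (\<lambda>n. f n = g n) U"
  using eq_equiv_class_iff[OF equiv_ultra_rel, of f g U] by (simp add: ultra_rel_def)

lemma isometric_point_sets_iff:
  assumes U: "ultrafilter U" "nonprincipal U"
    and XY: "1 \<le> k" "1 \<le> l" "X \<subseteq> tuples k" "Y \<subseteq> tuples l"
  shows "X \<approx>\<^bsub>U\<^esub> Y \<longleftrightarrow> asymp_equinumerous U X Y"
proof -
  have sub: "X \<subseteq> EE" "Y \<subseteq> EE" using XY by (auto simp: EE_def)
  have "eventually (\<lambda>n. (card (X \<inter> EEn n) = card (Y \<inter> EEn n)) \<longleftrightarrow>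
      (card (trunc X n) = card (trunc Y n))) U"
    using nonprincipal_eventually_ge[OF U, of k] nonprincipal_eventually_ge[OF U, of l]
    by eventually_elim (use XY in \<open>simp add: trunc_eq_Int_EEn\<close>)
  then have "eventually (\<lambda>n. card (X \<inter> EEn n) = card (Y \<inter> EEn n)) U \<longleftrightarrow>
      eventually (\<lambda>n. card (trunc X n) = card (trunc Y n)) U"
    by (rule eventually_subst)
  then show ?thesis using sub by (simp add: isometric_iff[OF U] asymp_equinumerous_def)
qed

section \<open>The map into the ultrapower\<close>

lemma count_class_respects:
  assumes U: "ultrafilter U" "nonprincipal U"
  shows "count_class U respects isom_rel U"
  by (rule congruentI) (simp add: isometric_iff[OF U] count_class_def ultra_class_eq_iff)

lemma phi_isom_class:
  assumes U: "ultrafilter U" "nonprincipal U" and X: "X \<subseteq> EE"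
  shows "phi U (isom_class U X) = ultra_class U (\<lambda>n. card (X \<inter> EEn n))"
  using UN_equiv_class[OF equiv_isom_rel[OF U] count_class_respects[OF U], of X] X
  by (simp add: phi_def count_class_def)

lemma phi_disjoint_union:
  assumes U: "ultrafilter U" "nonprincipal U" and XY: "X \<subseteq> EE" "Y \<subseteq> EE" "X \<inter> Y = {}"
  shows "phi U (isom_class U (X \<union> Y)) =
    ultra_add U (phi U (isom_class U X)) (phi U (isom_class U Y))"
proof -
  have "card ((X \<union> Y) \<inter> EEn n) = card (X \<inter> EEn n) + card (Y \<inter> EEn n)" for n
    unfolding Int_Un_distrib2
    by (rule card_Un_disjoint) (use XY(3) finite_EEn in auto)
  then show ?thesis using XY by (simp add: phi_isom_class[OF U] ultra_add_class)
qed

text \<open>The order on classes allows arbitrary representatives; the strict inequality of counts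
  does not depend on them, as changing one alters its counts only off a set in
  \<open>U\<close>.\<close>

lemma class_less_isom_class:
  assumes U: "quasi_selective U" and XY: "X \<subseteq> EE" "Y \<subseteq> EE"
  shows "class_less U (isom_class U X) (isom_class U Y) \<longleftrightarrow>
    eventually (\<lambda>n. card (X \<inter> EEn n) < card (Y \<inter> EEn n)) U"
proof
  have uf: "ultrafilter U" "nonprincipal U" using U by (auto simp: quasi_selective_def)
  assume "class_less U (isom_class U X) (isom_class U Y)"
  then obtain X1 Y1 where 1: "X \<approx>\<^bsub>U\<^esub> X1" "Y \<approx>\<^bsub>U\<^esub> Y1" "\<exists>Y'. Y' \<subset> Y1 \<and> X1 \<approx>\<^bsub>U\<^esub> Y'"
    by (auto simp: class_less_def)
  have "eventually (\<lambda>n. card (X1 \<inter> EEn n) < card (Y1 \<inter> EEn n)) U"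
    using 1 isometric_proper_subset_iff[OF U, of X1 Y1] by (simp add: isometric_iff[OF uf])
  moreover have "eventually (\<lambda>n. card (X \<inter> EEn n) = card (X1 \<inter> EEn n)) U"
    "eventually (\<lambda>n. card (Y \<inter> EEn n) = card (Y1 \<inter> EEn n)) U"
    using 1 by (auto simp: isometric_iff[OF uf])
  ultimately show "eventually (\<lambda>n. card (X \<inter> EEn n) < card (Y \<inter> EEn n)) U"
    by eventually_elim simp
next
  have uf: "ultrafilter U" "nonprincipal U" using U by (auto simp: quasi_selective_def)
  assume "eventually (\<lambda>n. card (X \<inter> EEn n) < card (Y \<inter> EEn n)) U"
  then have "\<exists>Y'. Y' \<subset> Y \<and> X \<approx>\<^bsub>U\<^esub> Y'" using isometric_proper_subset_iff[OF U XY] by simp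
  moreover have "X \<in> isom_class U X" "Y \<in> isom_class U Y"
    using XY by (auto simp: isometric_iff[OF uf])
  ultimately show "class_less U (isom_class U X) (isom_class U Y)"
    unfolding class_less_def by blast
qed

lemma ultra_less_class:
  fixes f g :: "nat \<Rightarrow> nat"
  assumes "ultrafilter U"
  shows "ultra_less U (ultra_class U f) (ultra_class U g) \<longleftrightarrow> eventually (\<lambda>n. f n < g n) U"
proof -
  have "ultra_less U (ultra_class U f) (ultra_class U g) \<longleftrightarrow>
      eventually (\<lambda>n. f n \<le> g n) U \<and> eventually (\<lambda>n. f n \<noteq> g n) U"
    using assms by (simp add: ultra_less_def ultra_le_class ultra_class_eq_iff
        ultrafilter_eventually_not_iff)
  also have "\<dots> \<longleftrightarrow> eventually (\<lambda>n. f n < g n) U"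
    by (simp add: eventually_conj_iff[symmetric] less_le)
  finally show ?thesis .
qed

text \<open>Injectivity is \<open>isometric_iff\<close>. Surjectivity realizes a function below
  \<open>card (EEn n)\<close> as the counts of a subset of \<open>EE\<close>.\<close>

lemma bij_betw_phi:
  assumes U: "quasi_selective U"
  shows "bij_betw (phi U) (Pow EE // isom_rel U) (ultra_segment U)"
  unfolding bij_betw_def
proof
  have uf: "ultrafilter U" "nonprincipal U" using U by (auto simp: quasi_selective_def)
  note eqv = equiv_isom_rel[OF uf] and phi = phi_isom_class[OF uf]
  show "inj_on (phi U) (Pow EE // isom_rel U)"
  proof (rule inj_onI)
    fix C D assume "C \<in> Pow EE // isom_rel U" "D \<in> Pow EE // isom_rel U" and eq: "phi U C = phi U D"
    then obtain X Y where X: "X \<subseteq> EE" "C = isom_class U X" and Y: "Y \<subseteq> EE" "D = isom_class U Y"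
      by (auto simp: quotient_def)
    then have "X \<approx>\<^bsub>U\<^esub> Y"
      using eq by (simp add: phi ultra_class_eq_iff isometric_iff[OF uf])
    then show "C = D" using X Y equiv_class_eq[OF eqv] by simp
  qed
  show "phi U ` (Pow EE // isom_rel U) = ultra_segment U"
  proof (intro equalityI subsetI)
    fix \<xi> assume "\<xi> \<in> phi U ` (Pow EE // isom_rel U)"
    then obtain X where X: "X \<subseteq> EE" "\<xi> = phi U (isom_class U X)"
      by (auto simp: quotient_def)
    have "card (X \<inter> EEn n) \<le> card (EEn n)" for n
      by (rule card_mono) (auto simp: finite_EEn)
    then show "\<xi> \<in> ultra_segment U"
      using X by (auto simp: phi ultra_segment_def ultrapower_def ultra_le_class quotientI)
  next
    fix \<xi> assume "\<xi> \<in> ultra_segment U"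
    then obtain f where f: "\<xi> = ultra_class U f" "eventually (\<lambda>n. f n \<le> card (EEn n)) U"
      by (auto simp: ultra_segment_def ultrapower_def quotient_def ultra_le_class)
    have "EE \<inter> EEn n = EEn n" for n using UN_EEn by blast
    then obtain Z where Z: "Z \<subseteq> EE" "eventually (\<lambda>n. card (Z \<inter> EEn n) = f n) U"
      using quasi_selective_realize_count[OF U, of f EE] f(2) by auto
    then have "\<xi> = phi U (isom_class U Z)" by (simp add: f(1) phi ultra_class_eq_iff eq_commute)
    moreover have "isom_class U Z \<in> Pow EE // isom_rel U" using Z(1) by (simp add: quotientI)
    ultimately show "\<xi> \<in> phi U ` (Pow EE // isom_rel U)" by blast
  qed
qed

theorem theorem5p6:
  fixes U :: "nat filter"
  assumes "quasi_selective U"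
  shows
    "equiv (Pow EE) (isom_rel U)
   \<and> (\<forall>X Y. X \<subseteq> EE \<longrightarrow> Y \<subseteq> EE \<longrightarrow>
        (\<forall>n. card (X \<inter> EEn n) \<le> card (Y \<inter> EEn n)) \<longrightarrow> (\<exists>Z. Z \<subseteq> Y \<and> X \<approx>\<^bsub>U\<^esub> Z))
   \<and> (\<forall>X Y. X \<subseteq> EE \<longrightarrow> Y \<subseteq> EE \<longrightarrow> (X \<approx>\<^bsub>U\<^esub> Y \<longleftrightarrow> (X - Y) \<approx>\<^bsub>U\<^esub> (Y - X)))
   \<and> (\<forall>X Y. X \<subseteq> EE \<longrightarrow> Y \<subseteq> EE \<longrightarrow>
        exactly_one (X \<approx>\<^bsub>U\<^esub> Y) (\<exists>X'. X' \<subset> X \<and> X' \<approx>\<^bsub>U\<^esub> Y) (\<exists>Y'. Y' \<subset> Y \<and> X \<approx>\<^bsub>U\<^esub> Y'))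
   \<and> (\<forall>k l X Y. k \<ge> 1 \<longrightarrow> l \<ge> 1 \<longrightarrow> X \<subseteq> tuples k \<longrightarrow> Y \<subseteq> tuples l \<longrightarrow>
        (X \<approx>\<^bsub>U\<^esub> Y \<longleftrightarrow> asymp_equinumerous U X Y))
   \<and> (count_class U respects isom_rel U)
   \<and> (\<forall>X. X \<subseteq> EE \<longrightarrow> phi U (isom_class U X) = ultra_class U (\<lambda>n. card (X \<inter> EEn n)))
   \<and> (\<forall>X Y. X \<subseteq> EE \<longrightarrow> Y \<subseteq> EE \<longrightarrow> X \<inter> Y = {} \<longrightarrow>
        phi U (isom_class U (X \<union> Y)) =
          ultra_add U (phi U (isom_class U X)) (phi U (isom_class U Y)))
   \<and> (\<forall>X Y. X \<subseteq> EE \<longrightarrow> Y \<subseteq> EE \<longrightarrow>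
        (class_less U (isom_class U X) (isom_class U Y) \<longleftrightarrow> (\<exists>Y'. Y' \<subset> Y \<and> X \<approx>\<^bsub>U\<^esub> Y')))
   \<and> bij_betw (phi U) (Pow EE // isom_rel U) (ultra_segment U)
   \<and> (\<forall>C \<in> Pow EE // isom_rel U. \<forall>D \<in> Pow EE // isom_rel U.
        class_less U C D \<longleftrightarrow> ultra_less U (phi U C) (phi U D))"
proof (intro conjI allI impI ballI)
  have U: "ultrafilter U" "nonprincipal U" using assms by (auto simp: quasi_selective_def)
  show "equiv (Pow EE) (isom_rel U)" by (rule equiv_isom_rel[OF U])
  show "count_class U respects isom_rel U" by (rule count_class_respects[OF U])
  show "bij_betw (phi U) (Pow EE // isom_rel U) (ultra_segment U)" by (rule bij_betw_phi[OF assms])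
  {
    fix X assume "X \<subseteq> EE"
    then show "phi U (isom_class U X) = ultra_class U (\<lambda>n. card (X \<inter> EEn n))"
      by (rule phi_isom_class[OF U])
  }
  {
    fix k l :: nat and X Y assume "1 \<le> k" "1 \<le> l" "X \<subseteq> tuples k" "Y \<subseteq> tuples l"
    then show "X \<approx>\<^bsub>U\<^esub> Y \<longleftrightarrow> asymp_equinumerous U X Y"
      by (rule isometric_point_sets_iff[OF U])
  }
  {
    fix C D assume "C \<in> Pow EE // isom_rel U" "D \<in> Pow EE // isom_rel U"
    then obtain X Y where "X \<subseteq> EE" "C = isom_class U X" "Y \<subseteq> EE" "D = isom_class U Y"
      by (auto simp: quotient_def)
    then show "class_less U C D \<longleftrightarrow> ultra_less U (phi U C) (phi U D)"
      by (simp add: class_less_isom_class[OF assms] phi_isom_class[OF U] ultra_less_class[OF U(1)])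
  }
  fix X Y assume XY: "X \<subseteq> EE" "Y \<subseteq> EE"
  show "class_less U (isom_class U X) (isom_class U Y) \<longleftrightarrow> (\<exists>Y'. Y' \<subset> Y \<and> X \<approx>\<^bsub>U\<^esub> Y')"
    using XY by (simp add: class_less_isom_class[OF assms] isometric_proper_subset_iff[OF assms])
  {
    assume "X \<inter> Y = {}"
    then show "phi U (isom_class U (X \<union> Y)) =
        ultra_add U (phi U (isom_class U X)) (phi U (isom_class U Y))"
      by (rule phi_disjoint_union[OF U XY])
  }
  {
    assume "\<forall>n. card (X \<inter> EEn n) \<le> card (Y \<inter> EEn n)"
    then obtain Z where Z: "Z \<subseteq> Y" "eventually (\<lambda>n. card (Z \<inter> EEn n) = card (X \<inter> EEn n)) U"
      using quasi_selective_realize_count[OF assms, of "\<lambda>n. card (X \<inter> EEn n)" Y] by auto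
    from Z(2) have "eventually (\<lambda>n. card (X \<inter> EEn n) = card (Z \<inter> EEn n)) U"
      by eventually_elim simp
    then have "X \<approx>\<^bsub>U\<^esub> Z" using XY Z(1) by (simp add: isometric_iff[OF U])
    then show "\<exists>Z. Z \<subseteq> Y \<and> X \<approx>\<^bsub>U\<^esub> Z" using Z(1) by blast
  }
  show "X \<approx>\<^bsub>U\<^esub> Y \<longleftrightarrow> (X - Y) \<approx>\<^bsub>U\<^esub> (Y - X)"
  proof -
    \<comment> \<open>For (E1), the common part of \<open>X\<close> and \<open>Y\<close> contributes
      equally to both counts and cancels.\<close>
    have "card (S \<inter> EEn n) = card (S \<inter> T \<inter> EEn n) + card ((S - T) \<inter> EEn n)" for S T n
    proof -
      have "S \<inter> EEn n = (S \<inter> T \<inter> EEn n) \<union> ((S - T) \<inter> EEn n)" by auto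
      then show ?thesis
        using card_Un_disjoint[of "S \<inter> T \<inter> EEn n" "(S - T) \<inter> EEn n"] finite_EEn by auto
    qed
    from this[of X _ Y] this[of Y _ X]
    have "card (X \<inter> EEn n) = card (Y \<inter> EEn n) \<longleftrightarrow>
        card ((X - Y) \<inter> EEn n) = card ((Y - X) \<inter> EEn n)" for n
      by (simp add: Int_commute)
    then show ?thesis using XY by (auto simp: isometric_iff[OF U])
  qed
  \<comment> \<open>Symmetry brings the middle alternative of (E2) into the form of
    \<open>isometric_proper_subset_iff\<close> with \<open>X\<close> and \<open>Y\<close>
    exchanged.\<close>
  have sym: "sym (isom_rel U)" using equiv_isom_rel[OF U] by (rule equivE)
  have "A \<approx>\<^bsub>U\<^esub> Y \<longleftrightarrow> Y \<approx>\<^bsub>U\<^esub> A" for A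
    by (rule iffI) (erule symD[OF sym])+
  then have "(\<exists>X'. X' \<subset> X \<and> X' \<approx>\<^bsub>U\<^esub> Y) \<longleftrightarrow> (\<exists>X'. X' \<subset> X \<and> Y \<approx>\<^bsub>U\<^esub> X')"
    by (intro ex_cong1 conj_cong refl)
  also have "\<dots> \<longleftrightarrow> eventually (\<lambda>n. card (Y \<inter> EEn n) < card (X \<inter> EEn n)) U"
    by (rule isometric_proper_subset_iff[OF assms XY(2,1)])
  finally have left: "(\<exists>X'. X' \<subset> X \<and> X' \<approx>\<^bsub>U\<^esub> Y) \<longleftrightarrow>
    eventually (\<lambda>n. card (Y \<inter> EEn n) < card (X \<inter> EEn n)) U" .
  have "X \<approx>\<^bsub>U\<^esub> Y \<longleftrightarrow> eventually (\<lambda>n. card (X \<inter> EEn n) = card (Y \<inter> EEn n)) U"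
    using XY by (simp add: isometric_iff[OF U])
  then show "exactly_one (X \<approx>\<^bsub>U\<^esub> Y) (\<exists>X'. X' \<subset> X \<and> X' \<approx>\<^bsub>U\<^esub> Y) (\<exists>Y'. Y' \<subset> Y \<and> X \<approx>\<^bsub>U\<^esub> Y')"
    unfolding left isometric_proper_subset_iff[OF assms XY]
    by (simp only: ultrafilter_exactly_one_less[OF U(1)])
qed

end
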